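(* Let $\alpha \ge 1$ be a real number. Then $$\lim_{n \to \infty} \int_{(0,1)^n} \frac{x_1^\alpha + \cdots + x_n^\alpha}{x_1 + \cdots + x_n} \, \mathrm{d}x_1 \cdots \mathrm{d}x_n = \frac{2}{\alpha+1}.$$
   Context: The integral is the Lebesgue integral over the open unit cube $(0,1)^n$, for integers $n \ge 1$. *)

theory Defs
  imports "HOL-Analysis.Analysis"
begin

text \<open>
  Since the dimension n varies, a point of n-space is a function on the index set {1..n}
  (extensional outside it) and n-dimensional Lebesgue measure is the n-fold product of
  \<^const>\<open>lborel\<close>. This is Lebesgue measure on the Borel sets, without completion; the integrands
  below are Borel measurable.
\<close>

abbreviation lborel_n :: "nat \<Rightarrow> (nat \<Rightarrow> real) measure" where
  "lborel_n n \<equiv> Pi\<^sub>M {1..n} (\<lambda>_. lborel)"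

abbreviation open_unit_cube :: "nat \<Rightarrow> (nat \<Rightarrow> real) set" where
  "open_unit_cube n \<equiv> Pi\<^sub>E {1..n} (\<lambda>_. {0<..<1})"

end

theory Submission
  imports Defs "HOL-Probability.Probability_Measure"
begin

text \<open>
  Regard the coordinates as independent uniform random variables on the unit interval. Write
  \<open>S\<close> for their sum, \<open>A\<close> for the sum of their powers, and \<open>c = 1 / (\<alpha> + 1)\<close> for the mean of one
  power. The quotient is compared with \<open>2 * A / n\<close>, whose expectation is exactly \<open>2 * c\<close>: in
  \<open>A / S - 2 * A / n = (A / S) * (1 - 2 * S / n)\<close>
  the factor \<open>A / S\<close> lies between 0 and 1, because \<open>x powr \<alpha> \<le> x\<close> on the unit interval when
  \<open>\<alpha> \<ge> 1\<close>. So the distance of the integral from \<open>2 * c\<close> is at most the expectation of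
  \<open>\<bar>1 - 2 * S / n\<bar>\<close>. The variables \<open>1 - 2 * x i\<close> are uncorrelated with mean 0 and second
  moment \<open>1/3\<close>, so their average has second moment \<open>1 / (3 * n)\<close>, and by the Cauchy--Schwarz
  inequality the distance is at most \<open>sqrt (1 / (3 * n))\<close>.

  Small values of \<open>S\<close> do no harm, since the division by \<open>S\<close> occurs only in the bounded
  factor \<open>A / S\<close>.
\<close>

section \<open>Integrals over the open unit interval\<close>

lemma set_lebesgue_integral_open_unit_interval:
  fixes f :: "real \<Rightarrow> real"
  assumes [measurable]: "f \<in> borel_measurable borel"
    and bound: "\<And>t. 0 < t \<Longrightarrow> t < 1 \<Longrightarrow> \<bar>f t\<bar> \<le> B"
    and I: "(f has_integral I) {0..1}"
  shows "set_integrable lborel {0<..<1} f" and "(LINT t:{0<..<1}|lborel. f t) = I"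
proof -
  show int: "set_integrable lborel {0<..<1} f"
    unfolding set_integrable_def
    by (rule integrableI_bounded_set_indicator[where B = B]) (auto simp: bound)
  have "(LINT t:{0<..<1}|lborel. f t) = integral {0<..<1} f"
    using int by (rule set_borel_integral_eq_integral(2))
  also have "\<dots> = I"
    using I by (simp add: integral_open_interval_real[symmetric] integral_unique)
  finally show "(LINT t:{0<..<1}|lborel. f t) = I" .
qed

lemma unit_interval_powr:
  fixes \<alpha> :: real
  assumes "\<alpha> \<ge> 0"
  shows "set_integrable lborel {0<..<1} (\<lambda>t. t powr \<alpha>)"
    and "(LINT t:{0<..<1}|lborel. t powr \<alpha>) = 1 / (\<alpha> + 1)"
proof -
  have I: "((\<lambda>t. t powr \<alpha>) has_integral 1 / (\<alpha> + 1)) {0..1}"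
    using has_integral_powr_from_0[of \<alpha> 1] assms by simp
  have B: "\<bar>t powr \<alpha>\<bar> \<le> 1" if "0 < t" "t < 1" for t :: real
    using that assms by (simp add: powr_le1)
  show "set_integrable lborel {0<..<1} (\<lambda>t. t powr \<alpha>)"
    and "(LINT t:{0<..<1}|lborel. t powr \<alpha>) = 1 / (\<alpha> + 1)"
    using set_lebesgue_integral_open_unit_interval[OF _ B I] by simp_all
qed

lemma unit_interval_centred:
  shows "set_integrable lborel {0<..<1} (\<lambda>t::real. 1 - 2 * t)"
    and "(LINT t:{0<..<1}|lborel. 1 - 2 * t) = (0::real)"
proof -
  have "((\<lambda>t::real. 1 - 2 * t) has_integral (1 - 1^2) - (0 - 0^2)) {0..1}"
    by (rule fundamental_theorem_of_calculus)
      (auto intro!: derivative_eq_intros simp flip: has_real_derivative_iff_has_vector_derivative)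
  then have I: "((\<lambda>t::real. 1 - 2 * t) has_integral 0) {0..1}"
    by simp
  have B: "\<bar>1 - 2 * t\<bar> \<le> 1" if "0 < t" "t < 1" for t :: real
    using that by auto
  show "set_integrable lborel {0<..<1} (\<lambda>t::real. 1 - 2 * t)"
    and "(LINT t:{0<..<1}|lborel. 1 - 2 * t) = (0::real)"
    using set_lebesgue_integral_open_unit_interval[OF _ B I] by simp_all
qed

lemma unit_interval_centred_square:
  shows "set_integrable lborel {0<..<1} (\<lambda>t::real. (1 - 2 * t)\<^sup>2)"
    and "(LINT t:{0<..<1}|lborel. (1 - 2 * t)\<^sup>2) = (1 / 3 :: real)"
proof -
  have "((\<lambda>t::real. (1 - 2 * t)\<^sup>2) has_integral (- ((1 - 2 * 1)^3) / 6) - (- ((1 - 2 * 0)^3) / 6)) {0..1}"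
    by (rule fundamental_theorem_of_calculus)
      (auto intro!: derivative_eq_intros simp flip: has_real_derivative_iff_has_vector_derivative)
  then have I: "((\<lambda>t::real. (1 - 2 * t)\<^sup>2) has_integral 1 / 3) {0..1}"
    by simp
  have B: "\<bar>(1 - 2 * t)\<^sup>2\<bar> \<le> 1" if "0 < t" "t < 1" for t :: real
    using that by (auto simp: abs_square_le_1)
  show "set_integrable lborel {0<..<1} (\<lambda>t::real. (1 - 2 * t)\<^sup>2)"
    and "(LINT t:{0<..<1}|lborel. (1 - 2 * t)\<^sup>2) = (1 / 3 :: real)"
    using set_lebesgue_integral_open_unit_interval[OF _ B I] by simp_all
qed

section \<open>The open unit cube as a probability space\<close>

interpretation lborel_power: product_sigma_finite "\<lambda>_::nat. lborel :: real measure"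
  by unfold_locales

abbreviation uniform_cube :: "nat \<Rightarrow> (nat \<Rightarrow> real) measure" where
  "uniform_cube n \<equiv> restrict_space (lborel_n n) (open_unit_cube n)"

lemma open_unit_cube_in_sets [measurable]: "open_unit_cube n \<in> sets (lborel_n n)"
  by (rule sets_PiM_I_finite) auto

lemma space_uniform_cube: "space (uniform_cube n) = open_unit_cube n"
  by (auto simp: space_restrict_space space_PiM)

lemma set_lebesgue_integral_open_unit_cube:
  fixes f :: "(nat \<Rightarrow> real) \<Rightarrow> real"
  shows "(LINT x:open_unit_cube n|lborel_n n. f x) = (LINT x|uniform_cube n. f x)"
  unfolding set_lebesgue_integral_def
  by (rule integral_restrict_space[symmetric]) (simp add: open_unit_cube_in_sets)

lemma prob_space_uniform_cube: "prob_space (uniform_cube n)"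
proof
  have "emeasure (uniform_cube n) (open_unit_cube n) = emeasure (lborel_n n) (open_unit_cube n)"
    by (rule emeasure_restrict_space) (auto simp: open_unit_cube_in_sets)
  also have "\<dots> = (\<Prod>i\<in>{1..n}. emeasure lborel {0<..<1::real})"
    by (rule lborel_power.emeasure_PiM) auto
  finally show "emeasure (uniform_cube n) (space (uniform_cube n)) = 1"
    by (simp add: space_uniform_cube)
qed

lemma borel_measurable_uniform_cube_component:
  fixes f :: "real \<Rightarrow> real"
  assumes "i \<in> {1..n}" and [measurable]: "f \<in> borel_measurable borel"
  shows "(\<lambda>x. f (x i)) \<in> borel_measurable (uniform_cube n)"
proof (rule measurable_restrict_space1)
  have "(\<lambda>x. x i) \<in> measurable (lborel_n n) lborel"
    using assms(1) by (rule measurable_component_singleton)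
  then show "(\<lambda>x. f (x i)) \<in> borel_measurable (lborel_n n)"
    by (rule measurable_compose) simp
qed

text \<open>Independence of the coordinates, in the form of multiplicativity of the expectation.\<close>

lemma expectation_prod_components:
  fixes f :: "nat \<Rightarrow> real \<Rightarrow> real"
  assumes J: "J \<subseteq> {1..n}"
    and int: "\<And>i. i \<in> J \<Longrightarrow> set_integrable lborel {0<..<1} (f i)"
  shows "integrable (uniform_cube n) (\<lambda>x. \<Prod>i\<in>J. f i (x i))"
    and "(LINT x|uniform_cube n. (\<Prod>i\<in>J. f i (x i))) = (\<Prod>i\<in>J. LINT t:{0<..<1}|lborel. f i t)"
proof -
  \<comment> \<open>On the product space the indicator function of the cube is itself a product over the
    coordinates; the coordinates outside \<open>J\<close> then contribute the factor 1, the length of the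
    interval.\<close>
  define g where "g i = (if i \<in> J then f i else (\<lambda>_. 1))" for i
  define h where "h i t = indicator {0<..<1} t * g i t" for i and t :: real
  have h_int: "integrable lborel (h i)" for i
    using int[of i] unfolding h_def g_def set_integrable_def by auto
  have h_prod: "(\<Prod>i\<in>{1..n}. h i (x i)) = indicator (open_unit_cube n) x *\<^sub>R (\<Prod>i\<in>J. f i (x i))"
    if "x \<in> space (lborel_n n)" for x
  proof -
    have "(\<Prod>i\<in>{1..n}. g i (x i)) = (\<Prod>i\<in>J. f i (x i))"
      using J by (intro prod.mono_neutral_cong_right) (auto simp: g_def)
    moreover have "(\<Prod>i\<in>{1..n}. indicator {0<..<1} (x i)) = (indicator (open_unit_cube n) x :: real)"
    proof (cases "x \<in> open_unit_cube n")
      case True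
      then have "indicator {0<..<1} (x i) = (1::real)" if "i \<in> {1..n}" for i
        using that by (auto simp: indicator_def PiE_iff)
      with True show ?thesis by simp
    next
      case False
      with that obtain i where "i \<in> {1..n}" "x i \<notin> {0<..<1}"
        by (auto simp: space_PiM PiE_iff)
      then have "(\<Prod>i\<in>{1..n}. indicator {0<..<1} (x i)) = (0::real)"
        by (intro prod_zero) (auto intro!: bexI[of _ i])
      with False show ?thesis by simp
    qed
    ultimately show ?thesis
      by (simp add: h_def prod.distrib)
  qed
  have "integrable (lborel_n n) (\<lambda>x. \<Prod>i\<in>{1..n}. h i (x i))"
    by (rule lborel_power.product_integrable_prod) (auto intro: h_int)
  then show "integrable (uniform_cube n) (\<lambda>x. \<Prod>i\<in>J. f i (x i))"
    using h_prod by (simp add: integrable_restrict_space open_unit_cube_in_sets cong: Bochner_Integration.integrable_cong)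
  have "(LINT x|uniform_cube n. (\<Prod>i\<in>J. f i (x i))) = (LINT x|lborel_n n. (\<Prod>i\<in>{1..n}. h i (x i)))"
    using h_prod
    by (simp add: integral_restrict_space open_unit_cube_in_sets cong: Bochner_Integration.integral_cong)
  also have "\<dots> = (\<Prod>i\<in>{1..n}. LINT t|lborel. h i t)"
    by (rule lborel_power.product_integral_prod) (auto intro: h_int)
  also have "\<dots> = (\<Prod>i\<in>J. LINT t:{0<..<1}|lborel. f i t)"
    using J by (intro prod.mono_neutral_cong_right)
      (auto simp: h_def g_def set_lebesgue_integral_def)
  finally show "(LINT x|uniform_cube n. (\<Prod>i\<in>J. f i (x i))) = (\<Prod>i\<in>J. LINT t:{0<..<1}|lborel. f i t)" .
qed

lemma expectation_component:
  fixes f :: "real \<Rightarrow> real"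
  assumes "i \<in> {1..n}" and "set_integrable lborel {0<..<1} f"
  shows "integrable (uniform_cube n) (\<lambda>x. f (x i))"
    and "(LINT x|uniform_cube n. f (x i)) = (LINT t:{0<..<1}|lborel. f t)"
  using expectation_prod_components[of "{i}" n "\<lambda>_. f"] assms by simp_all

lemma expectation_two_components:
  fixes f g :: "real \<Rightarrow> real"
  assumes "i \<in> {1..n}" "j \<in> {1..n}" "i \<noteq> j"
    and "set_integrable lborel {0<..<1} f" "set_integrable lborel {0<..<1} g"
  shows "integrable (uniform_cube n) (\<lambda>x. f (x i) * g (x j))"
    and "(LINT x|uniform_cube n. f (x i) * g (x j)) =
      (LINT t:{0<..<1}|lborel. f t) * (LINT t:{0<..<1}|lborel. g t)"
proof -
  have "integrable (uniform_cube n) (\<lambda>x. \<Prod>k\<in>{i,j}. (if k = i then f else g) (x k))"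
    and "(LINT x|uniform_cube n. (\<Prod>k\<in>{i,j}. (if k = i then f else g) (x k))) =
      (\<Prod>k\<in>{i,j}. LINT t:{0<..<1}|lborel. (if k = i then f else g) t)"
    using assms by (intro expectation_prod_components; auto)+
  with assms(3) show "integrable (uniform_cube n) (\<lambda>x. f (x i) * g (x j))"
    and "(LINT x|uniform_cube n. f (x i) * g (x j)) =
      (LINT t:{0<..<1}|lborel. f t) * (LINT t:{0<..<1}|lborel. g t)"
    by simp_all
qed

section \<open>Deviation of the sample mean\<close>

text \<open>The off-diagonal terms of the expanded square vanish, since the coordinates are
  independent and \<open>1 - 2 * x i\<close> has mean 0.\<close>

lemma second_moment_centred_sum:
  shows "integrable (uniform_cube n) (\<lambda>x. (\<Sum>i=1..n. 1 - 2 * x i)\<^sup>2)"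
    and "(LINT x|uniform_cube n. (\<Sum>i=1..n. 1 - 2 * x i)\<^sup>2) = n / 3"
proof -
  let ?y = "\<lambda>t::real. 1 - 2 * t"
  have cov: "integrable (uniform_cube n) (\<lambda>x. ?y (x i) * ?y (x j)) \<and>
      (LINT x|uniform_cube n. ?y (x i) * ?y (x j)) = (if i = j then 1 / 3 else 0)"
    if "i \<in> {1..n}" "j \<in> {1..n}" for i j
  proof (cases "i = j")
    case True
    then show ?thesis
      using expectation_component[OF that(1) unit_interval_centred_square(1)]
      by (simp add: unit_interval_centred_square(2) flip: power2_eq_square)
  next
    case False
    then show ?thesis
      using expectation_two_components[OF that False unit_interval_centred(1) unit_interval_centred(1)]
      by (simp add: unit_interval_centred(2))
  qed
  have square: "(\<Sum>i=1..n. ?y (x i))\<^sup>2 = (\<Sum>i=1..n. \<Sum>j=1..n. ?y (x i) * ?y (x j))" for x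
    by (simp only: power2_eq_square sum_product)
  show "integrable (uniform_cube n) (\<lambda>x. (\<Sum>i=1..n. ?y (x i))\<^sup>2)"
    unfolding square using cov by (intro Bochner_Integration.integrable_sum) blast
  have "(LINT x|uniform_cube n. (\<Sum>i=1..n. ?y (x i))\<^sup>2) =
      (\<Sum>i=1..n. LINT x|uniform_cube n. (\<Sum>j=1..n. ?y (x i) * ?y (x j)))"
    unfolding square using cov
    by (intro Bochner_Integration.integral_sum Bochner_Integration.integrable_sum) blast
  also have "\<dots> = (\<Sum>i=1..n. \<Sum>j=1..n. LINT x|uniform_cube n. ?y (x i) * ?y (x j))"
    using cov by (intro sum.cong refl Bochner_Integration.integral_sum) blast
  also have "\<dots> = (\<Sum>i=1..n. \<Sum>j=1..n. if i = j then 1 / 3 else 0)"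
    using cov by (intro sum.cong refl) blast
  also have "\<dots> = n / 3"
    by simp
  finally show "(LINT x|uniform_cube n. (\<Sum>i=1..n. ?y (x i))\<^sup>2) = n / 3" .
qed

lemma expectation_abs_sample_mean_deviation:
  assumes "n \<ge> 1"
  shows "integrable (uniform_cube n) (\<lambda>x. \<bar>1 - 2 * (\<Sum>i=1..n. x i) / n\<bar>)"
    and "(LINT x|uniform_cube n. \<bar>1 - 2 * (\<Sum>i=1..n. x i) / n\<bar>) \<le> sqrt (1 / (3 * real n))"
proof -
  interpret prob_space "uniform_cube n" by (rule prob_space_uniform_cube)
  define Y where "Y x = \<bar>1 - 2 * (\<Sum>i=1..n. x i) / n\<bar>" for x :: "nat \<Rightarrow> real"
  have Y_sq: "(Y x)\<^sup>2 = (\<Sum>i=1..n. 1 - 2 * x i)\<^sup>2 / n\<^sup>2" for x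
  proof -
    have "1 - 2 * (\<Sum>i=1..n. x i) / n = (\<Sum>i=1..n. 1 - 2 * x i) / n"
      using assms by (simp add: sum_subtractf sum_distrib_left diff_divide_distrib)
    then show ?thesis by (simp add: Y_def power_divide)
  qed
  have sq_int: "integrable (uniform_cube n) (\<lambda>x. (Y x)\<^sup>2)"
    unfolding Y_sq by (intro integrable_divide second_moment_centred_sum)
  have [measurable]: "(\<lambda>x. x i) \<in> borel_measurable (uniform_cube n)" if "i \<in> {1..n}" for i
    using borel_measurable_uniform_cube_component[OF that, of "\<lambda>t. t"] by simp
  have Y_meas: "Y \<in> borel_measurable (uniform_cube n)"
    unfolding Y_def by measurable
  show Y_int: "integrable (uniform_cube n) (\<lambda>x. \<bar>1 - 2 * (\<Sum>i=1..n. x i) / n\<bar>)"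
    using square_integrable_imp_integrable[OF Y_meas sq_int] unfolding Y_def .
  \<comment> \<open>The Cauchy--Schwarz inequality here is nonnegativity of the variance of \<open>Y\<close>.\<close>
  have "0 \<le> variance Y"
    by (rule variance_positive)
  also have "\<dots> = expectation (\<lambda>x. (Y x)\<^sup>2) - (expectation Y)\<^sup>2"
    using Y_int sq_int by (intro variance_eq) (auto simp: Y_def)
  finally have "(expectation Y)\<^sup>2 \<le> expectation (\<lambda>x. (Y x)\<^sup>2)"
    by simp
  also have "\<dots> = 1 / (3 * real n)"
    using assms unfolding Y_sq integral_divide_zero second_moment_centred_sum(2)
    by (simp add: power2_eq_square)
  finally have "expectation Y \<le> sqrt (1 / (3 * real n))"
    by (rule real_le_rsqrt)
  then show "(LINT x|uniform_cube n. \<bar>1 - 2 * (\<Sum>i=1..n. x i) / n\<bar>) \<le> sqrt (1 / (3 * real n))"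
    by (simp add: Y_def[abs_def])
qed

section \<open>The limit\<close>

theorem theorem2p1:
  fixes \<alpha> :: real
  assumes "\<alpha> \<ge> 1"
  shows "(\<lambda>n::nat. LINT x:open_unit_cube n|lborel_n n.
            (\<Sum>i=1..n. x i powr \<alpha>) / (\<Sum>i=1..n. x i))
          \<longlonglongrightarrow> 2 / (\<alpha> + 1)"
proof -
  define A where "A n x = (\<Sum>i=1..n. x i powr \<alpha>)" for n and x :: "nat \<Rightarrow> real"
  define S where "S n x = (\<Sum>i=1..n. x i)" for n and x :: "nat \<Rightarrow> real"
  have bound: "\<bar>(LINT x|uniform_cube n. A n x / S n x) - 2 / (\<alpha> + 1)\<bar> \<le> sqrt (1 / (3 * real n))"
    if n: "n \<ge> 1" for n
  proof -
    interpret prob_space "uniform_cube n" by (rule prob_space_uniform_cube)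
    have quotient: "0 \<le> A n x / S n x \<and> A n x / S n x \<le> 1 \<and> S n x > 0"
      if "x \<in> space (uniform_cube n)" for x
    proof -
      have x: "0 < x i" "x i < 1" if "i \<in> {1..n}" for i
        using \<open>x \<in> space (uniform_cube n)\<close> that by (auto simp: space_uniform_cube PiE_iff)
      have "x i powr \<alpha> \<le> x i" if "i \<in> {1..n}" for i
        using powr_mono'[of 1 \<alpha> "x i"] x[OF that] assms by simp
      then have "A n x \<le> S n x"
        unfolding A_def S_def by (rule sum_mono)
      moreover have "0 \<le> A n x"
        unfolding A_def by (intro sum_nonneg) simp
      moreover have "0 < S n x"
        unfolding S_def using n x by (intro sum_pos) auto
      ultimately show ?thesis by simp
    qed
    have [measurable]: "(\<lambda>x. x i) \<in> borel_measurable (uniform_cube n)" if "i \<in> {1..n}" for i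
      using borel_measurable_uniform_cube_component[OF that, of "\<lambda>t. t"] by simp
    have "(\<lambda>x. A n x / S n x) \<in> borel_measurable (uniform_cube n)"
      unfolding A_def S_def by measurable
    then have Q_int: "integrable (uniform_cube n) (\<lambda>x. A n x / S n x)"
      using quotient by (intro integrable_const_bound[where B = 1] AE_I2) (simp_all only: real_norm_def abs_of_nonneg)
    have A_int: "integrable (uniform_cube n) (A n)"
      unfolding A_def using assms
      by (intro Bochner_Integration.integrable_sum expectation_component unit_interval_powr) auto
    have "expectation (A n) = (\<Sum>i=1..n. LINT x|uniform_cube n. x i powr \<alpha>)"
      unfolding A_def using assms
      by (intro Bochner_Integration.integral_sum expectation_component unit_interval_powr) auto
    also have "\<dots> = (\<Sum>i=1..n. 1 / (\<alpha> + 1))"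
      using assms
      by (intro sum.cong refl trans[OF expectation_component(2) unit_interval_powr(2)]
            unit_interval_powr(1)) auto
    finally have "2 * expectation (A n) / n = 2 / (\<alpha> + 1)"
      using n by simp
    then have "expectation (\<lambda>x. A n x / S n x) - 2 / (\<alpha> + 1) =
        expectation (\<lambda>x. A n x / S n x - 2 * A n x / n)"
      using Q_int A_int by simp
    also have "\<bar>\<dots>\<bar> \<le> expectation (\<lambda>x. \<bar>A n x / S n x - 2 * A n x / n\<bar>)"
      by (rule integral_abs_bound)
    also have "\<dots> \<le> expectation (\<lambda>x. \<bar>1 - 2 * S n x / n\<bar>)"
    proof (rule integral_mono)
      show "integrable (uniform_cube n) (\<lambda>x. \<bar>A n x / S n x - 2 * A n x / n\<bar>)"
        using Q_int A_int by simp
      show "integrable (uniform_cube n) (\<lambda>x. \<bar>1 - 2 * S n x / n\<bar>)"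
        unfolding S_def using n by (rule expectation_abs_sample_mean_deviation)
      fix x assume x: "x \<in> space (uniform_cube n)"
      have "A n x / S n x - 2 * A n x / n = A n x / S n x * (1 - 2 * S n x / n)"
        using quotient[OF x] by (simp add: field_simps)
      also have "\<bar>\<dots>\<bar> \<le> 1 * \<bar>1 - 2 * S n x / n\<bar>"
        unfolding abs_mult using quotient[OF x]
        by (intro mult_right_mono) (simp_all only: abs_of_nonneg abs_ge_zero)
      finally show "\<bar>A n x / S n x - 2 * A n x / n\<bar> \<le> \<bar>1 - 2 * S n x / n\<bar>"
        by simp
    qed
    also have "\<dots> \<le> sqrt (1 / (3 * real n))"
      unfolding S_def using n by (rule expectation_abs_sample_mean_deviation)
    finally show ?thesis .
  qed
  have "(\<lambda>n. sqrt (1 / (3 * real n))) \<longlonglongrightarrow> sqrt (1 / 3 * 0)"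
    using lim_const_over_n[of "1 / 3 :: real"] by (intro tendsto_real_sqrt) simp
  then have "(\<lambda>n. sqrt (1 / (3 * real n))) \<longlonglongrightarrow> 0"
    by simp
  moreover have "\<forall>\<^sub>F n in sequentially.
      norm ((LINT x|uniform_cube n. A n x / S n x) - 2 / (\<alpha> + 1)) \<le> sqrt (1 / (3 * real n))"
    using eventually_ge_at_top[of "1::nat"] by eventually_elim (use bound in simp)
  ultimately have "(\<lambda>n. (LINT x|uniform_cube n. A n x / S n x) - 2 / (\<alpha> + 1)) \<longlonglongrightarrow> 0"
    by (rule Lim_null_comparison[rotated])
  then show ?thesis
    unfolding set_lebesgue_integral_open_unit_cube A_def S_def by (rule LIM_zero_cancel)
qed

end
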